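(* Let $m,n\ge 1$ be integers, let $A=\mathbb{Z}\langle x_1,x_2\rangle/(x_1^m,x_2^n)$ and $y=[x_1,x_2]$. In the abelian group $N_2(A)$: for $0\le i\le m-2$ the element $x_1^ix_2^{n-1}y$ is torsion of order $n$; for $0\le j\le n-2$ the element $x_1^{m-1}x_2^jy$ is torsion of order $m$; and the element $x_1^{m-1}x_2^{n-1}y$ is torsion of order $\gcd(m,n)$.
   Context: For an associative ring $A$, define $L_1(A)=A$ and $L_{i+1}(A)=[A,L_i(A)]$ (the additive span of all commutators $[a,l]=al-la$ with $a\in A$, $l\in L_i(A)$), $M_i(A)=A\,L_i(A)\,A$ (the two-sided ideal generated by $L_i(A)$), and $N_i(A)=M_i(A)/M_{i+1}(A)$. Elements of $M_2(A)$ are identified with their classes in $N_2(A)$. *)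

theory Defs
  imports "HOL-Algebra.Algebra" "HOL-Algebra.Algebraic_Closure_Type" "HOL-Library.Poly_Mapping"
begin

section \<open>The filtrations \<open>L\<^sub>i\<close>, \<open>M\<^sub>i\<close> and the quotients \<open>N\<^sub>i\<close>\<close>

definition ring_comm :: "('a, 'b) ring_scheme \<Rightarrow> 'a \<Rightarrow> 'a \<Rightarrow> 'a" where
  "ring_comm R a b = a \<otimes>\<^bsub>R\<^esub> b \<ominus>\<^bsub>R\<^esub> b \<otimes>\<^bsub>R\<^esub> a"

text \<open>The series is indexed from 1; the value at index 0 is a dummy.
  \<open>generate (add_monoid R)\<close> is the additive span.\<close>

fun lcs :: "('a, 'b) ring_scheme \<Rightarrow> nat \<Rightarrow> 'a set" where
  "lcs R 0 = carrier R"
| "lcs R (Suc 0) = carrier R"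
| "lcs R (Suc (Suc i)) =
     generate (add_monoid R) {ring_comm R a l | a l. a \<in> carrier R \<and> l \<in> lcs R (Suc i)}"

text \<open>\<open>genideal\<close> is the two-sided ideal generated by a set.\<close>

definition lcs_ideal :: "('a, 'b) ring_scheme \<Rightarrow> nat \<Rightarrow> 'a set" where
  "lcs_ideal R i = genideal R (lcs R i)"

text \<open>\<open>N\<^sub>i\<close> is an additive abelian group, represented as usual in \<open>HOL-Algebra\<close> by a
  \<open>monoid\<close> record whose operation is the addition of cosets.\<close>

definition lcs_quot :: "('a, 'b) ring_scheme \<Rightarrow> nat \<Rightarrow> 'a set monoid" where
  "lcs_quot R i =
     \<lparr>carrier = lcs_ideal R i, monoid.mult = (\<oplus>\<^bsub>R\<^esub>), one = \<zero>\<^bsub>R\<^esub>\<rparr> Mod lcs_ideal R (Suc i)"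

definition lcs_class :: "('a, 'b) ring_scheme \<Rightarrow> nat \<Rightarrow> 'a \<Rightarrow> 'a set" where
  "lcs_class R i a = lcs_ideal R (Suc i) +>\<^bsub>R\<^esub> a"

definition torsion_of_order :: "('a, 'b) monoid_scheme \<Rightarrow> 'a \<Rightarrow> nat \<Rightarrow> bool" where
  "torsion_of_order G x d \<longleftrightarrow> x \<in> carrier G \<and> d > 0 \<and> group.ord G x = d"

text \<open>\<open>group.ord\<close> is only specified on groups, so we record that \<open>N\<^sub>i\<close> is one.\<close>

context ring
begin

lemma ring_comm_closed:
  "a \<in> carrier R \<Longrightarrow> b \<in> carrier R \<Longrightarrow> ring_comm R a b \<in> carrier R"
  by (simp add: ring_comm_def)

lemma lcs_subset_carrier: "lcs R i \<subseteq> carrier R"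
proof (induction i rule: nat_less_induct)
  case (1 i)
  consider "i = 0" | "i = Suc 0" | j where "i = Suc (Suc j)"
    by (metis not0_implies_Suc)
  then show ?case
  proof cases
    case (3 j)
    then have "lcs R (Suc j) \<subseteq> carrier R"
      using 1 by blast
    then have "{ring_comm R a l | a l. a \<in> carrier R \<and> l \<in> lcs R (Suc j)}
        \<subseteq> carrier (add_monoid R)"
      using ring_comm_closed by auto
    then show ?thesis
      using 3 add.generate_incl by simp
  qed auto
qed

lemma ideal_lcs_ideal: "ideal (lcs_ideal R i) R"
  unfolding lcs_ideal_def by (rule genideal_ideal[OF lcs_subset_carrier])

lemma lcs_ideal_Suc_subset: "lcs_ideal R (Suc i) \<subseteq> lcs_ideal R i"
proof -
  interpret I: ideal "lcs_ideal R i" R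
    by (rule ideal_lcs_ideal)
  have sub: "lcs R i \<subseteq> lcs_ideal R i"
    unfolding lcs_ideal_def by (rule genideal_self[OF lcs_subset_carrier])
  have "lcs R (Suc i) \<subseteq> lcs_ideal R i"
  proof (cases i)
    case 0
    then show ?thesis using sub by simp
  next
    case (Suc j)
    have "ring_comm R a l \<in> lcs_ideal R i" if "a \<in> carrier R" "l \<in> lcs R i" for a l
      using that sub I.I_l_closed I.I_r_closed
      by (auto simp: ring_comm_def a_minus_def intro!: I.a_closed I.a_inv_closed)
    then have "{ring_comm R a l | a l. a \<in> carrier R \<and> l \<in> lcs R i} \<subseteq> lcs_ideal R i"
      by auto
    then show ?thesis
      using Suc add.generate_subgroup_incl[OF _ I.a_subgroup] by simp
  qed
  then show ?thesis
    unfolding lcs_ideal_def[of R "Suc i"] by (rule genideal_minimal[OF ideal_lcs_ideal])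
qed

lemma comm_group_lcs_quot: "comm_group (lcs_quot R i)"
proof -
  let ?M = "\<lparr>carrier = lcs_ideal R i, monoid.mult = (\<oplus>\<^bsub>R\<^esub>), one = \<zero>\<^bsub>R\<^esub>\<rparr>"
  interpret I: ideal "lcs_ideal R i" R
    by (rule ideal_lcs_ideal)
  interpret J: ideal "lcs_ideal R (Suc i)" R
    by (rule ideal_lcs_ideal)
  interpret M: comm_group ?M
  proof (rule comm_groupI)
    fix x assume "x \<in> carrier ?M"
    then show "\<exists>y\<in>carrier ?M. y \<otimes>\<^bsub>?M\<^esub> x = \<one>\<^bsub>?M\<^esub>"
      by (auto intro!: bexI[of _ "\<ominus> x"] simp: l_neg I.a_Hcarr)
  qed (auto simp: a_ac I.a_Hcarr I.a_closed)
  have inv: "inv\<^bsub>?M\<^esub> x = \<ominus> x" if "x \<in> lcs_ideal R i" for x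
    using that by (intro M.inv_equality) (auto simp: l_neg I.a_Hcarr)
  have nonempty: "lcs_ideal R (Suc i) = {} \<Longrightarrow> False"
    using additive_subgroup.zero_closed[OF J.additive_subgroup_axioms] by blast
  have "subgroup (lcs_ideal R (Suc i)) ?M"
    using lcs_ideal_Suc_subset[of i] inv
    by (intro M.subgroupI) (auto simp: J.a_closed subset_iff dest: nonempty)
  then show ?thesis
    unfolding lcs_quot_def by (rule M.abelian_FactGroup)
qed

end

section \<open>The ring \<open>\<int>\<langle>x\<^sub>1, x\<^sub>2\<rangle> / (x\<^sub>1\<^sup>m, x\<^sub>2\<^sup>n)\<close>\<close>

text \<open>The free monoid is written additively, because the convolution product on
  \<open>\<Rightarrow>\<^sub>0\<close> is the monoid algebra of an additively written (not necessarily
  commutative) monoid.\<close>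

datatype 'a free_monoid = Word "'a list"

instantiation free_monoid :: (type) monoid_add
begin

definition zero_free_monoid :: "'a free_monoid" where
  "0 = Word []"

fun plus_free_monoid :: "'a free_monoid \<Rightarrow> 'a free_monoid \<Rightarrow> 'a free_monoid" where
  "Word u + Word v = Word (u @ v)"

instance
proof
  fix a b c :: "'a free_monoid"
  show "a + b + c = a + (b + c)"
    by (cases a; cases b; cases c) simp
  show "0 + a = a" "a + 0 = a"
    by (cases a; simp add: zero_free_monoid_def)+
qed

end

datatype var = X1 | X2

type_synonym free_poly = "var free_monoid \<Rightarrow>\<^sub>0 int"

abbreviation free_ring :: "free_poly ring" where
  "free_ring \<equiv> ring_of_type_algebra"

lemma ring_free_ring: "ring free_ring"
proof -
  have "\<exists>y. x + y = 0" for x :: free_poly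
    using add.right_inverse by blast
  then show ?thesis
    unfolding ring_of_type_algebra_def
    by unfold_locales (auto simp: algebra_simps Units_def)
qed

definition free_var :: "var \<Rightarrow> free_poly" where
  "free_var v = Poly_Mapping.single (Word [v]) 1"

definition trunc_ideal :: "nat \<Rightarrow> nat \<Rightarrow> free_poly set" where
  "trunc_ideal m n =
     genideal free_ring
       {free_var X1 [^]\<^bsub>free_ring\<^esub> m, free_var X2 [^]\<^bsub>free_ring\<^esub> n}"

definition trunc_ring :: "nat \<Rightarrow> nat \<Rightarrow> free_poly set ring" where
  "trunc_ring m n = free_ring Quot trunc_ideal m n"

definition trunc_var :: "nat \<Rightarrow> nat \<Rightarrow> var \<Rightarrow> free_poly set" where
  "trunc_var m n v = trunc_ideal m n +>\<^bsub>free_ring\<^esub> free_var v"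

lemma ideal_trunc_ideal: "ideal (trunc_ideal m n) free_ring"
proof -
  interpret ring free_ring
    by (rule ring_free_ring)
  show ?thesis
    unfolding trunc_ideal_def
    by (rule genideal_ideal) (simp add: ring_of_type_algebra_def)
qed

lemma ring_trunc_ring: "ring (trunc_ring m n)"
  unfolding trunc_ring_def by (rule ideal.quotient_is_ring[OF ideal_trunc_ideal])

end

theory Submission
  imports Defs
begin

text \<open>
  Modulo \<open>M\<^sub>3\<close> commutators are central, so \<open>[x, z\<^sup>n] \<equiv> n z\<^sup>n\<^sup>-\<^sup>1 [x, z]\<close>; as \<open>x\<^sub>1\<^sup>m = x\<^sub>2\<^sup>n = 0\<close>, this
  makes \<open>m x\<^sub>1\<^sup>m\<^sup>-\<^sup>1 y\<close> and \<open>n x\<^sub>2\<^sup>n\<^sup>-\<^sup>1 y\<close> vanish in \<open>N\<^sub>2\<close>, which gives the upper bounds for the orders.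

  For the lower bounds, consider the additive functional on the free ring that sends a word with
  exactly \<open>a\<close> letters \<open>x\<^sub>1\<close> and \<open>b\<close> letters \<open>x\<^sub>2\<close> to its number of inversions (pairs with an \<open>x\<^sub>2\<close>
  before an \<open>x\<^sub>1\<close>), and all other words to 0. Inversions of a concatenation are additive up to a
  bilinear term in the letter counts, so the functional kills \<open>M\<^sub>3\<close> of the free ring. For
  \<open>a = i + 1 \<le> m\<close> and \<open>b = j + 1 \<le> n\<close> a word containing \<open>x\<^sub>1\<^sup>m\<close> has nonzero weight only if \<open>a = m\<close>,
  and then its weight is a multiple of \<open>m\<close>; likewise for \<open>x\<^sub>2\<^sup>n\<close>. But \<open>x\<^sub>1\<^sup>i x\<^sub>2\<^sup>j y\<close> has weight \<open>-1\<close>.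
\<close>

section \<open>Orders in the quotients \<open>N\<^sub>i\<close> and images of the filtration\<close>

text \<open>\<open>lcs_quot\<close> is a multiplicative record, so its powers correspond to additive
  multiples in the ring.\<close>

lemma (in ring) lcs_quot_nat_pow:
  assumes "a \<in> lcs_ideal R i"
  shows "lcs_class R i a [^]\<^bsub>lcs_quot R i\<^esub> (k::nat) = lcs_class R i ([k] \<cdot> a)"
proof -
  interpret I: ideal "lcs_ideal R i" R
    by (rule ideal_lcs_ideal)
  interpret J: ideal "lcs_ideal R (Suc i)" R
    by (rule ideal_lcs_ideal)
  have a: "a \<in> carrier R"
    using assms I.a_Hcarr by blast
  have mult: "U \<otimes>\<^bsub>lcs_quot R i\<^esub> V = U <+>\<^bsub>R\<^esub> V" for U V
    by (simp add: lcs_quot_def FactGroup_def set_mult_def set_add_def)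
  have one: "\<one>\<^bsub>lcs_quot R i\<^esub> = lcs_ideal R (Suc i)"
    by (simp add: lcs_quot_def FactGroup_def)
  show ?thesis
  proof (induction k)
    case 0
    then show ?case
      using J.a_rcos_const[OF J.zero_closed] one by (simp add: lcs_class_def)
  next
    case (Suc k)
    have "lcs_class R i a [^]\<^bsub>lcs_quot R i\<^esub> (Suc k) = lcs_class R i ([k] \<cdot> a) <+>\<^bsub>R\<^esub> lcs_class R i a"
      using Suc mult by (simp add: nat_pow_def)
    also have "\<dots> = lcs_class R i ([k] \<cdot> a \<oplus> a)"
      unfolding lcs_class_def using a by (intro J.a_rcos_sum) auto
    finally show ?case
      using a by simp
  qed
qed

text \<open>A coset is trivial exactly when its representative lies in the ideal, and
  \<open>ord_unique\<close> identifies the order as the \<open>d\<close> whose multiples are exactly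
  the exponents giving the identity. Orders thus become a question of ideal membership.\<close>

lemma (in ring) lcs_class_torsion_of_order:
  assumes a: "a \<in> lcs_ideal R i" and "d > 0"
    and iff: "\<And>k::nat. [k] \<cdot> a \<in> lcs_ideal R (Suc i) \<longleftrightarrow> d dvd k"
  shows "torsion_of_order (lcs_quot R i) (lcs_class R i a) d"
proof -
  interpret I: ideal "lcs_ideal R i" R
    by (rule ideal_lcs_ideal)
  interpret J: ideal "lcs_ideal R (Suc i)" R
    by (rule ideal_lcs_ideal)
  interpret Q: comm_group "lcs_quot R i"
    by (rule comm_group_lcs_quot)
  have carr: "lcs_class R i a \<in> carrier (lcs_quot R i)"
    using a by (auto simp: lcs_quot_def lcs_class_def FactGroup_def RCOSETS_def a_r_coset_def
      r_coset_def)
  have "lcs_class R i a [^]\<^bsub>lcs_quot R i\<^esub> k = \<one>\<^bsub>lcs_quot R i\<^esub> \<longleftrightarrow> d dvd k" for k :: nat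
  proof -
    have ka: "[k] \<cdot> a \<in> carrier R"
      using a I.a_Hcarr by blast
    have "lcs_class R i ([k] \<cdot> a) = lcs_ideal R (Suc i) \<longleftrightarrow> [k] \<cdot> a \<in> lcs_ideal R (Suc i)"
      unfolding lcs_class_def
      using a_coset_join1[OF _ ka J.a_subgroup] J.a_rcos_const by blast
    then show ?thesis
      using lcs_quot_nat_pow[OF a, of k] iff by (simp add: lcs_quot_def FactGroup_def)
  qed
  then have "Q.ord (lcs_class R i a) = d"
    using Q.ord_unique[OF carr] by blast
  then show ?thesis
    using carr \<open>d > 0\<close> by (simp add: torsion_of_order_def)
qed

text \<open>By surjectivity both entries of a commutator in \<open>S\<close> lift to
  \<open>R\<close>, and \<open>generate\<close> commutes with homomorphisms. This transports the
  series of the free ring to its quotient.\<close>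

lemma (in ring_hom_ring) lcs_image:
  assumes surj: "h ` carrier R = carrier S"
  shows "lcs S i = h ` lcs R i"
proof (induction i rule: induct_nat_012)
  case (ge2 i)
  have hc: "h (ring_comm R a l) = ring_comm S (h a) (h l)"
    if "a \<in> carrier R" "l \<in> carrier R" for a l
    using that by (simp add: ring_comm_def a_minus_def)
  have sub: "lcs R (Suc i) \<subseteq> carrier R"
    by (rule R.lcs_subset_carrier)
  let ?C = "{ring_comm R a l | a l. a \<in> carrier R \<and> l \<in> lcs R (Suc i)}"
  have "{ring_comm S a l | a l. a \<in> carrier S \<and> l \<in> lcs S (Suc i)} = h ` ?C"
  proof (intro equalityI subsetI)
    fix z assume "z \<in> {ring_comm S a l | a l. a \<in> carrier S \<and> l \<in> lcs S (Suc i)}"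
    then obtain a l where z: "z = ring_comm S a l" "a \<in> carrier S" "l \<in> lcs S (Suc i)"
      by blast
    obtain a' where "a' \<in> carrier R" "a = h a'"
      using surj z(2) by blast
    moreover obtain l' where "l' \<in> lcs R (Suc i)" "l = h l'"
      using ge2 z(3) by blast
    moreover from calculation have "z = h (ring_comm R a' l')"
      using hc[of a' l'] sub z(1) by (simp add: subset_iff)
    ultimately show "z \<in> h ` ?C"
      by blast
  next
    fix z assume "z \<in> h ` ?C"
    then obtain a l where z: "z = h (ring_comm R a l)" "a \<in> carrier R" "l \<in> lcs R (Suc i)"
      by blast
    then have "z = ring_comm S (h a) (h l)"
      using hc[of a l] sub by (simp add: subset_iff)
    moreover have "h a \<in> carrier S" "h l \<in> lcs S (Suc i)"
      using z(2,3) unfolding ge2 by simp_all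
    ultimately show "z \<in> {ring_comm S a l | a l. a \<in> carrier S \<and> l \<in> lcs S (Suc i)}"
      by blast
  qed
  moreover have "?C \<subseteq> carrier (add_monoid R)"
    using sub R.ring_comm_closed by auto
  ultimately show ?case
    using group_hom.generate_img[OF a_group_hom] by simp
qed (simp_all add: surj)

section \<open>Ideals of the free ring\<close>

lemma free_ring_simps:
  "carrier free_ring = UNIV" "p \<otimes>\<^bsub>free_ring\<^esub> q = p * q" "p \<oplus>\<^bsub>free_ring\<^esub> q = p + q"
  "\<zero>\<^bsub>free_ring\<^esub> = 0" "\<one>\<^bsub>free_ring\<^esub> = 1"
  by (simp_all add: ring_of_type_algebra_def)

lemma free_ring_a_inv: "\<ominus>\<^bsub>free_ring\<^esub> p = - p"
proof -
  interpret ring free_ring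
    by (rule ring_free_ring)
  show ?thesis
    by (rule minus_equality) (simp_all add: free_ring_simps)
qed

lemma free_ring_add_inv: "inv\<^bsub>add_monoid free_ring\<^esub> p = - p"
  using free_ring_a_inv by (simp only: a_inv_def)

lemma free_ring_minus: "p \<ominus>\<^bsub>free_ring\<^esub> q = p - q"
  by (simp add: a_minus_def free_ring_simps free_ring_a_inv)

lemma free_ring_nat_pow: "p [^]\<^bsub>free_ring\<^esub> (k::nat) = p ^ k"
  by (induction k) (simp_all add: free_ring_simps power_commutes)

lemma free_ring_comm: "ring_comm free_ring p q = p * q - q * p"
  by (simp add: ring_comm_def free_ring_simps free_ring_minus)

lemma free_ring_add_pow: "[(k::nat)] \<cdot>\<^bsub>free_ring\<^esub> p = of_nat k * p"
proof -
  interpret ring free_ring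
    by (rule ring_free_ring)
  show ?thesis
    by (induction k) (simp_all add: free_ring_simps algebra_simps)
qed

lemma free_ideal_closed:
  assumes "ideal I free_ring"
  shows "0 \<in> I" "p \<in> I \<Longrightarrow> q \<in> I \<Longrightarrow> p + q \<in> I" "p \<in> I \<Longrightarrow> q \<in> I \<Longrightarrow> p - q \<in> I"
    "p \<in> I \<Longrightarrow> - p \<in> I" "p \<in> I \<Longrightarrow> r * p \<in> I" "p \<in> I \<Longrightarrow> p * r \<in> I"
proof -
  interpret ideal I free_ring
    by (rule assms)
  note zero = additive_subgroup.zero_closed[OF is_additive_subgroup, unfolded free_ring_simps]
  note add = additive_subgroup.a_closed[OF is_additive_subgroup, unfolded free_ring_simps]
  note inv = additive_subgroup.a_inv_closed[OF is_additive_subgroup, unfolded free_ring_a_inv]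
  show "0 \<in> I"
    by (rule zero)
  show "p \<in> I \<Longrightarrow> q \<in> I \<Longrightarrow> p + q \<in> I"
    by (rule add)
  show "p \<in> I \<Longrightarrow> - p \<in> I"
    by (rule inv)
  show "p \<in> I \<Longrightarrow> q \<in> I \<Longrightarrow> p - q \<in> I"
    using add[of p "- q"] inv[of q] by auto
  show "p \<in> I \<Longrightarrow> r * p \<in> I"
    using I_l_closed[of p r] unfolding free_ring_simps by blast
  show "p \<in> I \<Longrightarrow> p * r \<in> I"
    using I_r_closed[of p r] unfolding free_ring_simps by blast
qed

lemma free_ideal_diff_cancel: "ideal I free_ring \<Longrightarrow> p - q \<in> I \<Longrightarrow> p \<in> I \<Longrightarrow> q \<in> I"
  using free_ideal_closed(3)[of I p "p - q"] by simp

lemma free_idealI: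
  assumes "0 \<in> I" and "\<And>p q. p \<in> I \<Longrightarrow> q \<in> I \<Longrightarrow> p - q \<in> I"
    and "\<And>p r. p \<in> I \<Longrightarrow> r * p \<in> I" and "\<And>p r. p \<in> I \<Longrightarrow> p * r \<in> I"
  shows "ideal I free_ring"
proof -
  interpret ring free_ring
    by (rule ring_free_ring)
  have uminus: "- p \<in> I" if "p \<in> I" for p
    using assms(2)[OF assms(1) that] by simp
  show ?thesis
  proof (rule idealI)
    show "subgroup I (add_monoid free_ring)"
    proof (rule add.subgroupI)
      show "\<ominus>\<^bsub>free_ring\<^esub> p \<in> I" if "p \<in> I" for p
        using uminus[OF that] by (simp only: free_ring_a_inv)
      show "p \<oplus>\<^bsub>free_ring\<^esub> q \<in> I" if "p \<in> I" "q \<in> I" for p q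
        using assms(2)[of p "- q"] that uminus by (simp add: free_ring_simps)
    qed (use assms(1) in \<open>auto simp: free_ring_simps\<close>)
  qed (use assms in \<open>auto simp: free_ring_simps intro: ring_free_ring\<close>)
qed

text \<open>The bracket is additive in its second entry, so membership for double commutators
  extends to brackets with arbitrary elements of L_2, and these span L_3.\<close>

lemma lcs_free_ring_3_subset:
  assumes I: "ideal I free_ring"
    and comm: "\<And>p q r. ring_comm free_ring p (ring_comm free_ring q r) \<in> I"
  shows "lcs free_ring 3 \<subseteq> I"
proof -
  interpret ring free_ring
    by (rule ring_free_ring)
  interpret I: ideal I free_ring
    by (rule I)
  have L2: "ring_comm free_ring p l \<in> I" if "l \<in> lcs free_ring 2" for p l
  proof -
    let ?C = "{ring_comm free_ring a l | a l. a \<in> carrier free_ring \<and> l \<in> lcs free_ring (Suc 0)}"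
    have "l \<in> generate (add_monoid free_ring) ?C"
      using that by (simp add: numeral_2_eq_2)
    then show ?thesis
    proof induction
      case one
      then show ?case
        using free_ideal_closed[OF I] by (simp add: free_ring_comm free_ring_simps)
    next
      case (incl l)
      then show ?case
        using comm by auto
    next
      case (inv l)
      then have "- ring_comm free_ring p l \<in> I"
        using comm free_ideal_closed[OF I] by auto
      then show ?case
        unfolding free_ring_add_inv by (simp add: free_ring_comm)
    next
      case (eng l l')
      then have "ring_comm free_ring p l + ring_comm free_ring p l' \<in> I"
        using free_ideal_closed[OF I] by auto
      then show ?case
        by (simp add: free_ring_comm free_ring_simps algebra_simps)
    qed
  qed
  have "generate (add_monoid free_ring) {ring_comm free_ring a l | a l.
      a \<in> carrier free_ring \<and> l \<in> lcs free_ring 2} \<subseteq> I"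
    using L2 by (intro add.generate_subgroup_incl I.a_subgroup) auto
  then show ?thesis
    by (simp add: numeral_3_eq_3 numeral_2_eq_2)
qed

lemma ring_comm_ring_comm_in_lcs_3:
  "ring_comm free_ring p (ring_comm free_ring q r) \<in> lcs free_ring 3"
proof -
  have "ring_comm free_ring q r \<in> lcs free_ring (Suc (Suc 0))"
    by (auto simp: free_ring_simps intro!: generate.incl)
  then have "ring_comm free_ring p (ring_comm free_ring q r) \<in> lcs free_ring (Suc (Suc (Suc 0)))"
    unfolding lcs.simps(3)[of _ "Suc 0"] by (auto simp: free_ring_simps intro!: generate.incl)
  then show ?thesis
    by (simp add: numeral_3_eq_3)
qed

text \<open>Bracketing with \<open>p\<close> is a derivation, and modulo \<open>I\<close> the
  element \<open>[p, q]\<close> commutes with \<open>q\<close>, so the Leibniz terms coming from a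
  power of \<open>q\<close> all coincide.\<close>

lemma comm_power_congruence:
  assumes I: "ideal I free_ring"
    and comm: "\<And>p q r. ring_comm free_ring p (ring_comm free_ring q r) \<in> I"
  shows "(p * q ^ Suc k - q ^ Suc k * p) - of_nat (Suc k) * q ^ k * (p * q - q * p) \<in> I"
    (is "?D k \<in> I")
proof (induction k)
  case 0
  then show ?case
    using free_ideal_closed[OF I] by simp
next
  case (Suc k)
  \<comment> \<open>The identity holds for arbitrary \<open>N\<close> and \<open>P\<close>; used
    with \<open>P = q ^ k\<close> and \<open>N = Suc k\<close>, it expresses
    \<open>?D (Suc k)\<close> by \<open>?D k\<close> and a double commutator.\<close>
  have "(p * (P * q * q) - P * q * q * p) - (1 + N) * (P * q) * (p * q - q * p)
      = ((p * (P * q) - P * q * p) - N * P * (p * q - q * p)) * q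
        - N * P * (q * (p * q - q * p) - (p * q - q * p) * q)" for N P :: free_poly
    by (simp add: algebra_simps)
  from this[of "q ^ k" "of_nat (Suc k)"]
  have "?D (Suc k) = ?D k * q - of_nat (Suc k) * q ^ k * ring_comm free_ring q (ring_comm free_ring p q)"
    by (simp only: free_ring_comm power_Suc2 of_nat_Suc[of "Suc k"])
  moreover have "?D k * q \<in> I"
    using Suc by (rule free_ideal_closed[OF I])
  moreover have "of_nat (Suc k) * q ^ k * ring_comm free_ring q (ring_comm free_ring p q) \<in> I"
    using comm by (rule free_ideal_closed[OF I])
  ultimately show ?case
    using free_ideal_closed(3)[OF I] by presburger
qed

section \<open>The inversion functional\<close>

fun inversions :: "var list \<Rightarrow> nat" where
  "inversions [] = 0"
| "inversions (X1 # w) = inversions w"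
| "inversions (X2 # w) = inversions w + count_list w X1"

text \<open>The product term counts the inversions across the cut, with the \<open>X2\<close> in
  \<open>u\<close> and the \<open>X1\<close> in \<open>v\<close>.\<close>

lemma inversions_append:
  "inversions (u @ v) = inversions u + inversions v + count_list u X2 * count_list v X1"
  by (induction u rule: inversions.induct) auto

lemma inversions_replicate [simp]: "inversions (replicate k v) = 0"
  by (cases v; induction k) auto

lemma count_list_replicate: "count_list (replicate k a) b = (if a = b then k else 0)"
  by (induction k) auto

fun word_weight :: "nat \<Rightarrow> nat \<Rightarrow> var free_monoid \<Rightarrow> int" where
  "word_weight a b (Word w) =
     (if count_list w X1 = a \<and> count_list w X2 = b then int (inversions w) else 0)"

definition inversion_form :: "nat \<Rightarrow> nat \<Rightarrow> free_poly \<Rightarrow> int" where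
  "inversion_form a b p =
     (\<Sum>w\<in>Poly_Mapping.keys p. Poly_Mapping.lookup p w * word_weight a b w)"

abbreviation monomial :: "var list \<Rightarrow> free_poly" where
  "monomial w \<equiv> Poly_Mapping.single (Word w) 1"

lemma inversion_form_add: "inversion_form a b (p + q) = inversion_form a b p + inversion_form a b q"
  unfolding inversion_form_def
  by (rule setsum_keys_plus_distrib[where f = "\<lambda>k c. c * word_weight a b k"])
    (simp_all add: algebra_simps)

lemma inversion_form_diff: "inversion_form a b (p - q) = inversion_form a b p - inversion_form a b q"
  using inversion_form_add[of a b "p - q" q] by simp

lemma inversion_form_monomial [simp]: "inversion_form a b (monomial w) = word_weight a b (Word w)"
  by (simp add: inversion_form_def)

lemma monomial_mult: "monomial u * monomial v = monomial (u @ v)"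
  by (simp add: mult_single)

lemma free_var_power: "free_var v ^ k = monomial (replicate k v)"
proof (induction k)
  case 0
  then show ?case
    by (simp flip: zero_free_monoid_def)
qed (simp add: free_var_def monomial_mult)

text \<open>Additively the free ring is the free abelian group on the words, so
  \<open>frag_induction\<close> applies.\<close>

lemma dvd_additive_free_polyI:
  fixes G :: "free_poly \<Rightarrow> int"
  assumes diff: "\<And>p q. G (p - q) = G p - G q" and monomial: "\<And>w. d dvd G (monomial w)"
  shows "d dvd G p"
proof (rule frag_induction[of p UNIV])
  show "d dvd G 0"
    using diff[of 0 0] by simp
  show "d dvd G (Poly_Mapping.single w 1)" for w
    using monomial by (cases w) simp
qed (simp_all add: diff)

text \<open>The largest two-sided ideal on which \<open>inversion_form\<close> is divisible by \<open>d\<close>.\<close>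

definition inversion_ideal :: "nat \<Rightarrow> nat \<Rightarrow> int \<Rightarrow> free_poly set" where
  "inversion_ideal a b d = {f. \<forall>p q. d dvd inversion_form a b (p * f * q)}"

lemma ideal_inversion_ideal: "ideal (inversion_ideal a b d) free_ring"
proof (rule free_idealI)
  show "0 \<in> inversion_ideal a b d"
    by (simp add: inversion_ideal_def inversion_form_def)
  show "f - g \<in> inversion_ideal a b d"
    if "f \<in> inversion_ideal a b d" "g \<in> inversion_ideal a b d" for f g
    using that
    by (simp add: inversion_ideal_def inversion_form_diff left_diff_distrib right_diff_distrib)
  fix f r assume "f \<in> inversion_ideal a b d"
  then have f: "d dvd inversion_form a b (p * f * q)" for p q
    by (simp add: inversion_ideal_def)
  have "d dvd inversion_form a b (p * (r * f) * q)" "d dvd inversion_form a b (p * (f * r) * q)" for p q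
    using f[of "p * r" q] f[of p "r * q"] by (simp_all only: mult.assoc)
  then show "r * f \<in> inversion_ideal a b d" "f * r \<in> inversion_ideal a b d"
    unfolding inversion_ideal_def by blast+
qed

text \<open>The form is additive in each of the two multipliers, so they can be reduced to words one
  after the other.\<close>

lemma inversion_idealI:
  assumes "\<And>u v. d dvd inversion_form a b (monomial u * f * monomial v)"
  shows "f \<in> inversion_ideal a b d"
proof -
  have right: "d dvd inversion_form a b (monomial u * f * q)" for u q
    by (rule dvd_additive_free_polyI[where G = "\<lambda>q. inversion_form a b (monomial u * f * q)"])
      (simp_all only: inversion_form_diff right_diff_distrib assms)
  have "d dvd inversion_form a b (p * f * q)" for p q
    by (rule dvd_additive_free_polyI[where G = "\<lambda>p. inversion_form a b (p * f * q)"])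
      (simp_all only: inversion_form_diff left_diff_distrib right)
  then show ?thesis
    by (simp add: inversion_ideal_def)
qed

text \<open>The form is even 0 here. The four words of \<open>pqr - prq - qrp + rqp\<close> have the
  same letter counts, and each relative order of two of the factors occurs once with each sign, so
  the cross terms cancel; so do the terms involving \<open>u\<close>, \<open>v\<close> or a single
  factor.\<close>

lemma triple_comm_monomial_in_inversion_ideal:
  "ring_comm free_ring (monomial p) (ring_comm free_ring (monomial q) (monomial r)) \<in> inversion_ideal a b d"
proof (rule inversion_idealI)
  fix u v
  show "d dvd inversion_form a b
    (monomial u * ring_comm free_ring (monomial p) (ring_comm free_ring (monomial q) (monomial r)) * monomial v)"
    by (simp add: free_ring_comm left_diff_distrib right_diff_distrib monomial_mult
        inversion_form_diff) (simp add: inversions_append algebra_simps)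
qed

lemma free_ring_comm_diff:
  "ring_comm free_ring (p - p') q = ring_comm free_ring p q - ring_comm free_ring p' q"
  "ring_comm free_ring q (p - p') = ring_comm free_ring q p - ring_comm free_ring q p'"
  by (simp_all add: free_ring_comm left_diff_distrib right_diff_distrib)

lemma triple_comm_in_inversion_ideal:
  "ring_comm free_ring p (ring_comm free_ring q r) \<in> inversion_ideal a b d"
proof -
  let ?G = "\<lambda>s t p q r. inversion_form a b (s * ring_comm free_ring p (ring_comm free_ring q r) * t)"
  note diff = free_ring_comm_diff left_diff_distrib right_diff_distrib inversion_form_diff
  have T: "d dvd ?G s t (monomial u) (monomial v) (monomial w)" for s t u v w
    using triple_comm_monomial_in_inversion_ideal[of u v w a b d] by (simp add: inversion_ideal_def)
  \<comment> \<open>The three entries are extended from words to arbitrary elements one at a time,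
    the innermost first.\<close>
  have T': "d dvd ?G s t (monomial u) (monomial v) r" for s t u v
    by (rule dvd_additive_free_polyI[where G = "?G s t (monomial u) (monomial v)"])
      (simp_all only: diff T)
  have T'': "d dvd ?G s t (monomial u) q r" for s t u
    by (rule dvd_additive_free_polyI[where G = "\<lambda>q. ?G s t (monomial u) q r"])
      (simp_all only: diff T')
  have "d dvd ?G s t p q r" for s t
    by (rule dvd_additive_free_polyI[where G = "\<lambda>p. ?G s t p q r"])
      (simp_all only: diff T'')
  then show ?thesis
    by (simp add: inversion_ideal_def)
qed

lemma inversions_eq_0: "count_list w X1 = 0 \<or> count_list w X2 = 0 \<Longrightarrow> inversions w = 0"
  by (induction w rule: inversions.induct) (auto split: if_splits)

text \<open>It suffices to treat the two generators between words \<open>u\<close> and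
  \<open>v\<close>. If the weight can be nonzero, the block uses up all occurrences of its letter,
  so every inversion involves the block, and the weight is a multiple of the block length.\<close>

lemma trunc_ideal_subset_inversion_ideal:
  assumes "i < m" and "j < n"
    and dm: "Suc i = m \<Longrightarrow> d dvd int m" and dn: "Suc j = n \<Longrightarrow> d dvd int n"
  shows "trunc_ideal m n \<subseteq> inversion_ideal (Suc i) (Suc j) d"
proof -
  interpret ring free_ring
    by (rule ring_free_ring)
  have "monomial (replicate m X1) \<in> inversion_ideal (Suc i) (Suc j) d"
  proof (rule inversion_idealI)
    fix u v
    consider "count_list (u @ replicate m X1 @ v) X1 \<noteq> Suc i"
      | "count_list u X1 = 0" "count_list v X1 = 0" "Suc i = m"
      using \<open>i < m\<close> by (force simp: count_list_replicate)
    then show "d dvd inversion_form (Suc i) (Suc j)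
        (monomial u * monomial (replicate m X1) * monomial v)"
    proof cases
      case 2
      then show ?thesis
        \<comment> \<open>The inversions pair an \<open>X2\<close> of \<open>u\<close> with a letter
          of the block, so there are \<open>m * count_list u X2\<close> of them.\<close>
        using dm by (simp add: monomial_mult inversions_append inversions_eq_0 count_list_replicate)
    qed (auto simp: monomial_mult)
  qed
  moreover have "monomial (replicate n X2) \<in> inversion_ideal (Suc i) (Suc j) d"
  proof (rule inversion_idealI)
    fix u v
    consider "count_list (u @ replicate n X2 @ v) X2 \<noteq> Suc j"
      | "count_list u X2 = 0" "count_list v X2 = 0" "Suc j = n"
      using \<open>j < n\<close> by (force simp: count_list_replicate)
    then show "d dvd inversion_form (Suc i) (Suc j)
        (monomial u * monomial (replicate n X2) * monomial v)"
    proof cases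
      case 2
      then show ?thesis
        \<comment> \<open>Here a letter of the block is paired with an \<open>X1\<close> of
          \<open>v\<close>, which gives \<open>n * count_list v X1\<close>.\<close>
        using dn by (simp add: monomial_mult inversions_append inversions_eq_0 count_list_replicate)
    qed (auto simp: monomial_mult)
  qed
  ultimately show ?thesis
    unfolding trunc_ideal_def free_ring_nat_pow free_var_power
    by (intro genideal_minimal ideal_inversion_ideal) auto
qed

section \<open>The elements \<open>x\<^sub>1\<^sup>i x\<^sub>2\<^sup>j y\<close>\<close>

abbreviation comm_elem :: "nat \<Rightarrow> nat \<Rightarrow> free_poly" where
  "comm_elem i j \<equiv> free_var X1 ^ i * free_var X2 ^ j * ring_comm free_ring (free_var X1) (free_var X2)"

lemma inversion_form_of_nat_mult: "inversion_form a b (of_nat k * f) = int k * inversion_form a b f"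
proof (induction k)
  case 0
  then show ?case
    by (simp add: inversion_form_def)
qed (simp add: inversion_form_add algebra_simps)

text \<open>The two words in the expansion end in \<open>X1, X2\<close> and \<open>X2, X1\<close>;
  they have \<open>j\<close> and \<open>j + 1\<close> inversions.\<close>

lemma inversion_form_comm_elem: "inversion_form (Suc i) (Suc j) (comm_elem i j) = - 1"
proof -
  have "comm_elem i j = monomial (replicate i X1 @ replicate j X2 @ [X1, X2])
      - monomial (replicate i X1 @ replicate j X2 @ [X2, X1])"
    unfolding free_ring_comm free_var_power by (simp add: free_var_def right_diff_distrib monomial_mult)
  then show ?thesis
    by (simp add: inversion_form_diff inversions_append count_list_replicate)
qed

lemma dvd_if_comm_elem_in_inversion_ideal:
  assumes "of_nat k * comm_elem i j \<in> inversion_ideal (Suc i) (Suc j) d"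
  shows "d dvd int k"
proof -
  have "d dvd inversion_form (Suc i) (Suc j) (1 * (of_nat k * comm_elem i j) * 1)"
    using assms unfolding inversion_ideal_def by blast
  then show ?thesis
    by (simp only: mult_1_left mult_1_right inversion_form_of_nat_mult inversion_form_comm_elem) simp
qed

text \<open>The commutator of \<open>x1\<close> with \<open>x2 ^ n\<close> lies in \<open>I\<close>
  along with the power itself, and it is congruent to \<open>n * x2 ^ (n - 1) * y\<close>. The
  factor \<open>x1 ^ i\<close> is then multiplied on from the left.\<close>

lemma of_nat_mult_comm_elem_X2:
  assumes I: "ideal I free_ring"
    and comm: "\<And>p q r. ring_comm free_ring p (ring_comm free_ring q r) \<in> I"
    and "n \<ge> 1" and pow: "free_var X2 ^ n \<in> I"
  shows "of_nat n * comm_elem i (n - 1) \<in> I"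
proof -
  note closed = free_ideal_closed[OF I]
  let ?p = "free_var X1" and ?q = "free_var X2"
  have "(?p * ?q ^ n - ?q ^ n * ?p) - of_nat n * ?q ^ (n - 1) * (?p * ?q - ?q * ?p) \<in> I"
    using comm_power_congruence[OF I comm, of ?p ?q "n - 1"] \<open>n \<ge> 1\<close> by simp
  moreover have "?p * ?q ^ n - ?q ^ n * ?p \<in> I"
    by (rule closed(3)[OF closed(5)[OF pow] closed(6)[OF pow]])
  ultimately have "of_nat n * ?q ^ (n - 1) * (?p * ?q - ?q * ?p) \<in> I"
    by (rule free_ideal_diff_cancel[OF I])
  then have "?p ^ i * (of_nat n * ?q ^ (n - 1) * (?p * ?q - ?q * ?p)) \<in> I"
    by (rule closed)
  moreover have "?p ^ i * (of_nat n * ?q ^ (n - 1) * c) = of_nat n * (?p ^ i * ?q ^ (n - 1) * c)" for c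
    using mult_of_nat_commute[of n "?p ^ i"] by (simp only: flip: mult.assoc)
  ultimately show ?thesis
    by (simp only: free_ring_comm)
qed

text \<open>The argument for \<open>x2 ^ n\<close> with the variables exchanged, which changes the
  sign of the commutator. The factor \<open>x2 ^ j\<close> must now stand between
  \<open>x1 ^ (m - 1)\<close> and \<open>y\<close>, so it is multiplied on from the right and moved
  past \<open>y\<close>.\<close>

lemma of_nat_mult_comm_elem_X1:
  assumes I: "ideal I free_ring"
    and comm: "\<And>p q r. ring_comm free_ring p (ring_comm free_ring q r) \<in> I"
    and "m \<ge> 1" and pow: "free_var X1 ^ m \<in> I"
  shows "of_nat m * comm_elem (m - 1) j \<in> I"
proof -
  note closed = free_ideal_closed[OF I]
  let ?p = "free_var X2" and ?q = "free_var X1"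
  define c where "c = ring_comm free_ring ?q ?p"
  define Q where "Q = of_nat m * ?q ^ (m - 1)"
  have "(?p * ?q ^ m - ?q ^ m * ?p) - Q * (- c) \<in> I"
    using comm_power_congruence[OF I comm, of ?p ?q "m - 1"] \<open>m \<ge> 1\<close>
    by (simp add: Q_def c_def free_ring_comm)
  moreover have "?p * ?q ^ m - ?q ^ m * ?p \<in> I"
    by (rule closed(3)[OF closed(5)[OF pow] closed(6)[OF pow]])
  ultimately have "Q * (- c) \<in> I"
    by (rule free_ideal_diff_cancel[OF I])
  then have "Q * c \<in> I"
    using closed(4) by fastforce
  moreover have "ring_comm free_ring (?p ^ j) c \<in> I"
    unfolding c_def by (rule comm)
  \<comment> \<open>The second summand corrects \<open>c * x2 ^ j\<close> to
    \<open>x2 ^ j * c\<close>.\<close>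
  ultimately have "Q * c * ?p ^ j + Q * ring_comm free_ring (?p ^ j) c \<in> I"
    by (intro closed(2) closed(5)[of "ring_comm _ _ _"] closed(6)[of "Q * c"])
  moreover have "Q * c * ?p ^ j + Q * ring_comm free_ring (?p ^ j) c = of_nat m * comm_elem (m - 1) j"
    by (simp add: Q_def c_def[symmetric] free_ring_comm[of "?p ^ j"] algebra_simps)
  ultimately show ?thesis
    by simp
qed

text \<open>A Bezout combination of the two given multiples.\<close>

lemma gcd_mult_in_free_ideal:
  assumes I: "ideal I free_ring" and "of_nat m * f \<in> I" and "of_nat n * f \<in> I"
  shows "of_nat (gcd m n) * f \<in> I"
proof -
  obtain u v where "u * int m + v * int n = int (gcd m n)"
    using bezout_int[of "int m" "int n"] by auto
  then have "(of_nat (gcd m n) :: free_poly) = of_int (u * int m + v * int n)"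
    by (simp only: of_int_of_nat_eq)
  then have eq: "of_nat (gcd m n) * f = of_int u * (of_nat m * f) + of_int v * (of_nat n * f)"
    by (simp only: of_int_add of_int_mult of_int_of_nat_eq distrib_right mult.assoc)
  show ?thesis
    unfolding eq using assms(2,3)[THEN free_ideal_closed(5)[OF I]] by (rule free_ideal_closed(2)[OF I])
qed

section \<open>Passage from the free ring to the truncated ring\<close>

locale trunc =
  fixes m n :: nat and A h
  defines "A \<equiv> trunc_ring m n"
    and "h \<equiv> (\<lambda>f. trunc_ideal m n +>\<^bsub>free_ring\<^esub> f)"
begin

sublocale A: ring A
  unfolding A_def by (rule ring_trunc_ring)

sublocale ring_hom_ring free_ring A h
  unfolding A_def h_def trunc_ring_def
  by (rule ideal.rcos_ring_hom_ring[OF ideal_trunc_ideal])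

lemma proj_surj: "h ` carrier free_ring = carrier A"
  by (auto simp: A_def h_def trunc_ring_def FactRing_def A_RCOSETS_def' )

text \<open>Taking the preimage of M_3 keeps all computations in the free ring, where words are
  available.\<close>

definition lift_3 :: "free_poly set" where
  "lift_3 = {f. h f \<in> lcs_ideal A 3}"

lemma ideal_lift_3: "ideal lift_3 free_ring"
  using ideal_vimage[OF A.ideal_lcs_ideal[of 3]] by (simp add: lift_3_def free_ring_simps)

lemma triple_comm_in_lift_3: "ring_comm free_ring p (ring_comm free_ring q r) \<in> lift_3"
  using ring_comm_ring_comm_in_lcs_3[of p q r] lcs_image[OF proj_surj, of 3]
    A.genideal_self[OF A.lcs_subset_carrier[of 3]]
  by (auto simp: lift_3_def lcs_ideal_def)

lemma power_in_lift_3: "free_var X1 ^ m \<in> lift_3" "free_var X2 ^ n \<in> lift_3"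
proof -
  interpret I: ideal "trunc_ideal m n" free_ring
    by (rule ideal_trunc_ideal)
  interpret L: ideal "lcs_ideal A 3" A
    by (rule A.ideal_lcs_ideal)
  have "h f \<in> lcs_ideal A 3" if "f \<in> trunc_ideal m n" for f
  proof -
    have "h f = \<zero>\<^bsub>A\<^esub>"
      using I.a_rcos_const[OF that] by (simp add: h_def A_def trunc_ring_def FactRing_def)
    then show ?thesis
      using additive_subgroup.zero_closed[OF L.is_additive_subgroup] by simp
  qed
  moreover have "free_var X1 ^ m \<in> trunc_ideal m n" "free_var X2 ^ n \<in> trunc_ideal m n"
    unfolding trunc_ideal_def free_ring_nat_pow
    using R.genideal_self[of "{free_var X1 ^ m, free_var X2 ^ n}"] by (simp_all add: free_ring_simps)
  ultimately show "free_var X1 ^ m \<in> lift_3" "free_var X2 ^ n \<in> lift_3"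
    by (simp_all add: lift_3_def)
qed

text \<open>The image of \<open>J\<close> is an ideal containing L_3 of \<open>A\<close>, hence M_3;
  since \<open>J\<close> contains the kernel of \<open>h\<close>, it is the full preimage of its
  image.\<close>

lemma lift_3_subset:
  assumes J: "ideal J free_ring" and "trunc_ideal m n \<subseteq> J"
    and comm: "\<And>p q r. ring_comm free_ring p (ring_comm free_ring q r) \<in> J"
  shows "lift_3 \<subseteq> J"
proof
  fix f assume f: "f \<in> lift_3"
  have J': "ideal (h ` J) A"
    using R.ring_ideal_imp_quot_ideal[OF ideal_trunc_ideal J]
    by (simp add: h_def A_def trunc_ring_def)
  have "lcs A 3 \<subseteq> h ` J"
    using lcs_free_ring_3_subset[OF J comm] lcs_image[OF proj_surj, of 3] by auto
  then have "lcs_ideal A 3 \<subseteq> h ` J"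
    unfolding lcs_ideal_def by (rule A.genideal_minimal[OF J'])
  then have "h f \<in> h ` J"
    using f by (auto simp: lift_3_def)
  moreover have "h ` J \<subseteq> carrier A"
    using proj_surj by (auto simp: free_ring_simps)
  ultimately have "f \<in> \<Union> (h ` J)"
    using R.canonical_proj_vimage_mem_iff[OF ideal_trunc_ideal, of "h ` J" m n f]
    by (simp add: h_def A_def trunc_ring_def free_ring_simps)
  moreover have "J = \<Union> (h ` J)"
    using R.ideal_incl_iff[OF ideal_trunc_ideal J, of m n] assms(2) by (simp add: h_def)
  ultimately show "f \<in> J"
    by simp
qed

text \<open>All three orders are instances of this criterion. The relation \<open>x1 ^ m = 0\<close>
  constrains \<open>d\<close> only for \<open>i = m - 1\<close>, and \<open>x2 ^ n = 0\<close> only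
  for \<open>j = n - 1\<close>. The inversion ideal for \<open>d\<close> bounds the order from
  below, \<open>mult\<close> from above.\<close>

lemma comm_elem_torsion:
  assumes "i < m" and "j < n" and "d > 0"
    and dm: "Suc i = m \<Longrightarrow> d dvd m" and dn: "Suc j = n \<Longrightarrow> d dvd n"
    and mult: "of_nat d * comm_elem i j \<in> lift_3"
  shows "torsion_of_order (lcs_quot A 2) (lcs_class A 2 (h (comm_elem i j))) d"
proof (rule A.lcs_class_torsion_of_order)
  have "ring_comm free_ring (free_var X1) (free_var X2) \<in> lcs free_ring 2"
    by (auto simp: free_ring_simps numeral_2_eq_2 intro!: generate.incl)
  then have "h (ring_comm free_ring (free_var X1) (free_var X2)) \<in> lcs_ideal A 2"
    using A.genideal_self[OF A.lcs_subset_carrier[of 2]] lcs_image[OF proj_surj, of 2]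
    by (auto simp: lcs_ideal_def)
  then show "h (comm_elem i j) \<in> lcs_ideal A 2"
    using free_ideal_closed(5)[OF ideal_vimage[OF A.ideal_lcs_ideal[of 2]]]
    by (simp add: free_ring_simps)
  show "[k] \<cdot>\<^bsub>A\<^esub> h (comm_elem i j) \<in> lcs_ideal A (Suc 2) \<longleftrightarrow> d dvd k" for k :: nat
  proof -
    have "[k] \<cdot>\<^bsub>A\<^esub> h f = h (of_nat k * f)" for f
      by (induction k) (simp_all add: hom_zero[unfolded free_ring_simps] distrib_right
          hom_add[unfolded free_ring_simps] A.a_comm hom_closed[unfolded free_ring_simps])
    then have "[k] \<cdot>\<^bsub>A\<^esub> h (comm_elem i j) \<in> lcs_ideal A (Suc 2)
        \<longleftrightarrow> of_nat k * comm_elem i j \<in> lift_3"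
      by (simp add: lift_3_def)
    also have "\<dots> \<longleftrightarrow> d dvd k"
    proof
      assume "of_nat k * comm_elem i j \<in> lift_3"
      moreover have "lift_3 \<subseteq> inversion_ideal (Suc i) (Suc j) (int d)"
        using assms by (intro lift_3_subset ideal_inversion_ideal trunc_ideal_subset_inversion_ideal
            triple_comm_in_inversion_ideal) auto
      ultimately show "d dvd k"
        using dvd_if_comm_elem_in_inversion_ideal[of k i j "int d"] by auto
    next
      assume "d dvd k"
      then obtain l where "k = l * d"
        by (metis dvd_def mult.commute)
      then have "of_nat k * comm_elem i j = of_nat l * (of_nat d * comm_elem i j)"
        by (simp add: mult.assoc)
      then show "of_nat k * comm_elem i j \<in> lift_3"
        using free_ideal_closed(5)[OF ideal_lift_3 mult] by simp
    qed
    finally show ?thesis .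
  qed
qed (fact \<open>d > 0\<close>)

lemma hom_comm_elem:
  "h (comm_elem i j) = h (free_var X1) [^]\<^bsub>A\<^esub> i \<otimes>\<^bsub>A\<^esub> h (free_var X2) [^]\<^bsub>A\<^esub> j
    \<otimes>\<^bsub>A\<^esub> ring_comm A (h (free_var X1)) (h (free_var X2))"
proof -
  have "h (free_var X1 [^]\<^bsub>free_ring\<^esub> i \<otimes>\<^bsub>free_ring\<^esub> free_var X2 [^]\<^bsub>free_ring\<^esub> j
      \<otimes>\<^bsub>free_ring\<^esub> (free_var X1 \<otimes>\<^bsub>free_ring\<^esub> free_var X2
        \<ominus>\<^bsub>free_ring\<^esub> free_var X2 \<otimes>\<^bsub>free_ring\<^esub> free_var X1))
    = h (free_var X1) [^]\<^bsub>A\<^esub> i \<otimes>\<^bsub>A\<^esub> h (free_var X2) [^]\<^bsub>A\<^esub> j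
      \<otimes>\<^bsub>A\<^esub> (h (free_var X1) \<otimes>\<^bsub>A\<^esub> h (free_var X2)
        \<ominus>\<^bsub>A\<^esub> h (free_var X2) \<otimes>\<^bsub>A\<^esub> h (free_var X1))"
    using free_ring_simps(1) by (simp add: a_minus_def hom_nat_pow)
  then show ?thesis
    by (simp add: ring_comm_def free_ring_nat_pow free_ring_simps)
qed

end

theorem theorem3p3:
  fixes m n :: nat
  assumes "m \<ge> 1" and "n \<ge> 1"
  defines "A \<equiv> trunc_ring m n"
  defines "x1 \<equiv> trunc_var m n X1"
  defines "x2 \<equiv> trunc_var m n X2"
  defines "y \<equiv> ring_comm A x1 x2"
  shows "(\<forall>i::nat. i + 2 \<le> m \<longrightarrow>
            torsion_of_order (lcs_quot A 2)
              (lcs_class A 2 (x1 [^]\<^bsub>A\<^esub> i \<otimes>\<^bsub>A\<^esub> x2 [^]\<^bsub>A\<^esub> (n - 1) \<otimes>\<^bsub>A\<^esub> y)) n)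
       \<and> (\<forall>j::nat. j + 2 \<le> n \<longrightarrow>
            torsion_of_order (lcs_quot A 2)
              (lcs_class A 2 (x1 [^]\<^bsub>A\<^esub> (m - 1) \<otimes>\<^bsub>A\<^esub> x2 [^]\<^bsub>A\<^esub> j \<otimes>\<^bsub>A\<^esub> y)) m)
       \<and> torsion_of_order (lcs_quot A 2)
            (lcs_class A 2 (x1 [^]\<^bsub>A\<^esub> (m - 1) \<otimes>\<^bsub>A\<^esub> x2 [^]\<^bsub>A\<^esub> (n - 1) \<otimes>\<^bsub>A\<^esub> y)) (gcd m n)"
proof -
  define h where "h = (\<lambda>f. trunc_ideal m n +>\<^bsub>free_ring\<^esub> f)"
  interpret T: trunc m n A h
    by unfold_locales (simp_all add: A_def h_def)
  have elem: "x1 [^]\<^bsub>A\<^esub> i \<otimes>\<^bsub>A\<^esub> x2 [^]\<^bsub>A\<^esub> j \<otimes>\<^bsub>A\<^esub> y = h (comm_elem i j)" for i j :: nat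
    using T.hom_comm_elem[of i j] by (simp only: x1_def x2_def y_def h_def trunc_var_def)
  have n_mult: "of_nat n * comm_elem i (n - 1) \<in> T.lift_3" for i
    using T.ideal_lift_3 T.triple_comm_in_lift_3 \<open>n \<ge> 1\<close> T.power_in_lift_3(2)
    by (rule of_nat_mult_comm_elem_X2)
  have m_mult: "of_nat m * comm_elem (m - 1) j \<in> T.lift_3" for j
    using T.ideal_lift_3 T.triple_comm_in_lift_3 \<open>m \<ge> 1\<close> T.power_in_lift_3(1)
    by (rule of_nat_mult_comm_elem_X1)
  have gcd_mult: "of_nat (gcd m n) * comm_elem (m - 1) (n - 1) \<in> T.lift_3"
    by (rule gcd_mult_in_free_ideal[OF T.ideal_lift_3 m_mult n_mult])
  show ?thesis
    unfolding elem
  proof (intro conjI allI impI)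
    fix i assume "i + 2 \<le> m"
    then show "torsion_of_order (lcs_quot A 2) (lcs_class A 2 (h (comm_elem i (n - 1)))) n"
      \<comment> \<open>The bound \<open>i + 2 \<le> m\<close> rules out \<open>Suc i = m\<close>,
        so \<open>d = n\<close> only has to divide \<open>n\<close>.\<close>
      using \<open>n \<ge> 1\<close> by (intro T.comm_elem_torsion[OF _ _ _ _ _ n_mult]) auto
  next
    fix j assume "j + 2 \<le> n"
    then show "torsion_of_order (lcs_quot A 2) (lcs_class A 2 (h (comm_elem (m - 1) j))) m"
      using \<open>m \<ge> 1\<close> by (intro T.comm_elem_torsion[OF _ _ _ _ _ m_mult]) auto
  next
    show "torsion_of_order (lcs_quot A 2) (lcs_class A 2 (h (comm_elem (m - 1) (n - 1)))) (gcd m n)"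
      \<comment> \<open>Both exponents are maximal, so \<open>d\<close> must divide both
        \<open>m\<close> and \<open>n\<close>, as the gcd does.\<close>
      using assms(1,2) by (intro T.comm_elem_torsion[OF _ _ _ _ _ gcd_mult]) auto
  qed
qed

end
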